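(* Let $(N,S)$ be a Nijenhuis structure on a LieYRep pair $((\mathfrak g,[\cdot,\cdot],[\![\cdot,\cdot,\cdot]\!]),(V;\rho,\mu))$. Then a linear deformation of this pair is generated by $(\phi,\varphi_1,\varphi_2;\varrho,\varpi_1,\varpi_2)$, where for all $x,y,z\in\mathfrak g$ $$\phi(x,y)=[Nx,y]+[x,Ny]-N[x,y],$$ $$\varphi_1(x,y,z)=[\![Nx,y,z]\!]+[\![x,Ny,z]\!]+[\![x,y,Nz]\!]-N[\![x,y,z]\!],$$ $$\varphi_2(x,y,z)=[\![Nx,Ny,z]\!]+[\![x,Ny,Nz]\!]+[\![Nx,y,Nz]\!]-N\varphi_1(x,y,z),$$ $$\varrho(x)=\rho(Nx)+\rho(x)\circ S-S\circ\rho(x),$$ $$\varpi_1(x,y)=\mu(Nx,y)+\mu(x,Ny)+\mu(x,y)\circ S-S\circ\mu(x,y),$$ $$\varpi_2(x,y)=\mu(Nx,y)\circ S+\mu(x,Ny)\circ S+\mu(Nx,Ny)-S\circ\varpi_1(x,y).$$ Moreover, this deformation is trivial.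
   Context: All vector spaces are finite-dimensional over a field $\mathbb K$ of characteristic $0$. A Lie-Yamaguti algebra is a vector space $\mathfrak g$ with a bilinear map $[\cdot,\cdot]:\wedge^2\mathfrak g\to\mathfrak g$ and a trilinear map $[\![\cdot,\cdot,\cdot]\!]:\wedge^2\mathfrak g\otimes\mathfrak g\to\mathfrak g$ such that for all $x,y,z,w,t\in\mathfrak g$: (1) $[[x,y],z]+[[y,z],x]+[[z,x],y]+[\![x,y,z]\!]+[\![y,z,x]\!]+[\![z,x,y]\!]=0$; (2) $[\![[x,y],z,w]\!]+[\![[y,z],x,w]\!]+[\![[z,x],y,w]\!]=0$; (3) $[\![x,y,[z,w]]\!]=[[\![x,y,z]\!],w]+[z,[\![x,y,w]\!]]$; (4) $[\![x,y,[\![z,w,t]\!]]\!]=[\![[\![x,y,z]\!],w,t]\!]+[\![z,[\![x,y,w]\!],t]\!]+[\![z,w,[\![x,y,t]\!]]\!]$. A representation $(V;\rho,\mu)$ of $\mathfrak g$ is a vector space $V$ with linear maps $\rho:\mathfrak g\to\mathfrak{gl}(V)$, $\mu:\otimes^2\mathfrak g\to\mathfrak{gl}(V)$ such that, with $D(x,y)=D_{\rho,\mu}(x,y):=\mu(y,x)-\mu(x,y)+[\rho(x),\rho(y)]-\rho([x,y])$, for all $x,y,z,w\in\mathfrak g$: $\mu([x,y],z)-\mu(x,z)\rho(y)+\mu(y,z)\rho(x)=0$; $\mu(x,[y,z])-\rho(y)\mu(x,z)+\rho(z)\mu(x,y)=0$; $\rho([\![x,y,z]\!])=[D(x,y),\rho(z)]$;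 $\mu(z,w)\mu(x,y)-\mu(y,w)\mu(x,z)-\mu(x,[\![y,z,w]\!])+D(y,z)\mu(x,w)=0$; $\mu([\![x,y,z]\!],w)+\mu(z,[\![x,y,w]\!])=[D(x,y),\mu(z,w)]$. A Lie-Yamaguti algebra together with a representation is called a LieYRep pair. Nijenhuis structure: for $N\in\mathfrak{gl}(\mathfrak g)$, $S\in\mathfrak{gl}(V)$, define $\phi,\varphi_1,\varphi_2,\varrho,\varpi_1,\varpi_2$ by the six formulas displayed in the claim. The pair $(N,S)$ is a Nijenhuis structure on the LieYRep pair if for all $x,y,z\in\mathfrak g$: $N\phi(x,y)=[Nx,Ny]$, $N\varphi_2(x,y,z)=[\![Nx,Ny,Nz]\!]$, $\rho(Nx)\circ S=S\circ\varrho(x)$, $\mu(Nx,Ny)\circ S=S\circ\varpi_2(x,y)$. Linear deformation: $(\phi,\varphi_i;\varrho,\varpi_i)$ (with $\phi:\wedge^2\mathfrak g\to\mathfrak g$, $\varphi_i:\wedge^2\mathfrak g\otimes\mathfrak g\to\mathfrak g$, $\varrho:\mathfrak g\to\mathfrak{gl}(V)$, $\varpi_i:\otimes^2\mathfrak g\to\mathfrak{gl}(V)$) generates a linear deformation if, with $[x,y]_t=[x,y]+t\phi(x,y)$, $[\![x,y,z]\!]_t=[\![x,y,z]\!]+t\varphi_1(x,y,z)+t^2\varphi_2(x,y,z)$, $\rho_t=\rho+t\varrho$, $\mu_t=\mu+t\varpi_1+t^2\varpi_2$, the data $((\mathfrak g,[\cdot,\cdot]_t,[\![\cdot,\cdot,\cdot]\!]_t),(V;\rho_t,\mu_t))$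 form a LieYRep pair for all $t$. Homomorphisms of LieYRep pairs from $(\mathfrak g,\rho_V,\mu_V)$ to $(\mathfrak h,\rho_W,\mu_W)$: pairs $(\alpha,\beta)$ with $\alpha:\mathfrak g\to\mathfrak h$ linear preserving both brackets and $\beta:V\to W$ linear with $\beta(\rho_V(x)v)=\rho_W(\alpha(x))\beta(v)$, $\beta(\mu_V(x,y)v)=\mu_W(\alpha(x),\alpha(y))\beta(v)$. A linear deformation is trivial if there are $N'\in\mathfrak{gl}(\mathfrak g)$, $S'\in\mathfrak{gl}(V)$ such that $(\mathrm{Id}_{\mathfrak g}+tN',\mathrm{Id}_V+tS')$ is an isomorphism from the deformed pair $(\mathfrak g,[\cdot,\cdot]_t,[\![\cdot,\cdot,\cdot]\!]_t;\rho_t,\mu_t)$ to the original pair; this is understood as: it is a homomorphism for all $t$ (hence an isomorphism whenever both maps are invertible). *)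

theory Defs
  imports Complex_Main "HOL-Library.Function_Algebras"
begin

text \<open>
  Vector spaces are whole types with an explicit scalar multiplication over a field of
  characteristic 0.  Elements of \<open>gl(V)\<close> are functions \<open>'v \<Rightarrow> 'v\<close> that are linear; their sums,
  differences and \<open>0\<close> are the pointwise ones of \<^theory>\<open>HOL-Library.Function_Algebras\<close>, while the
  product of \<open>gl(V)\<close> is composition \<open>\<circ>\<close> (never \<open>*\<close>, which would be pointwise).
\<close>

definition fin_dim_vs :: "('k::field_char_0 \<Rightarrow> 'v::ab_group_add \<Rightarrow> 'v) \<Rightarrow> bool" where
  "fin_dim_vs s \<longleftrightarrow> (\<exists>B. finite_dimensional_vector_space s B)"

definition op_scale :: "('k \<Rightarrow> 'v \<Rightarrow> 'v) \<Rightarrow> 'k \<Rightarrow> ('u \<Rightarrow> 'v) \<Rightarrow> 'u \<Rightarrow> 'v" where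
  "op_scale s c f = (\<lambda>v. s c (f v))"

lemma vector_space_op_scale:
  fixes s :: "'k::field \<Rightarrow> 'v::ab_group_add \<Rightarrow> 'v"
  assumes "vector_space s"
  shows "vector_space (op_scale s :: 'k \<Rightarrow> ('u \<Rightarrow> 'v) \<Rightarrow> 'u \<Rightarrow> 'v)"
proof -
  interpret vector_space s by fact
  show ?thesis
    by unfold_locales
      (auto simp: op_scale_def fun_eq_iff scale_right_distrib scale_left_distrib)
qed

definition gl :: "('k::field \<Rightarrow> 'v::ab_group_add \<Rightarrow> 'v) \<Rightarrow> ('v \<Rightarrow> 'v) set" where
  "gl s = {f. Vector_Spaces.linear s s f}"

definition commutator :: "('v::ab_group_add \<Rightarrow> 'v) \<Rightarrow> ('v \<Rightarrow> 'v) \<Rightarrow> 'v \<Rightarrow> 'v" where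
  "commutator f g = (f \<circ> g) - (g \<circ> f)"

definition bilinear_map ::
  "('k::field \<Rightarrow> 'a::ab_group_add \<Rightarrow> 'a) \<Rightarrow> ('k \<Rightarrow> 'b::ab_group_add \<Rightarrow> 'b) \<Rightarrow>
   ('k \<Rightarrow> 'c::ab_group_add \<Rightarrow> 'c) \<Rightarrow> ('a \<Rightarrow> 'b \<Rightarrow> 'c) \<Rightarrow> bool" where
  "bilinear_map s1 s2 s3 f \<longleftrightarrow>
     (\<forall>x. Vector_Spaces.linear s2 s3 (\<lambda>y. f x y)) \<and>
     (\<forall>y. Vector_Spaces.linear s1 s3 (\<lambda>x. f x y))"

text \<open>Linear maps \<open>\<Lambda>\<^sup>2 g \<rightarrow> g\<close>, given as alternating bilinear maps.\<close>

definition wedge2_map ::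
  "('k::field \<Rightarrow> 'g::ab_group_add \<Rightarrow> 'g) \<Rightarrow> ('g \<Rightarrow> 'g \<Rightarrow> 'g) \<Rightarrow> bool" where
  "wedge2_map s f \<longleftrightarrow> bilinear_map s s s f \<and> (\<forall>x. f x x = 0)"

text \<open>Linear maps \<open>\<Lambda>\<^sup>2 g \<otimes> g \<rightarrow> g\<close>, given as trilinear maps alternating in the first two arguments.\<close>

definition wedge2_tensor_map ::
  "('k::field \<Rightarrow> 'g::ab_group_add \<Rightarrow> 'g) \<Rightarrow> ('g \<Rightarrow> 'g \<Rightarrow> 'g \<Rightarrow> 'g) \<Rightarrow> bool" where
  "wedge2_tensor_map s f \<longleftrightarrow>
     (\<forall>y z. Vector_Spaces.linear s s (\<lambda>x. f x y z)) \<and>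
     (\<forall>x z. Vector_Spaces.linear s s (\<lambda>y. f x y z)) \<and>
     (\<forall>x y. Vector_Spaces.linear s s (\<lambda>z. f x y z)) \<and>
     (\<forall>x z. f x x z = 0)"

definition gl_map ::
  "('k::field \<Rightarrow> 'g::ab_group_add \<Rightarrow> 'g) \<Rightarrow> ('k \<Rightarrow> 'v::ab_group_add \<Rightarrow> 'v) \<Rightarrow>
   ('g \<Rightarrow> 'v \<Rightarrow> 'v) \<Rightarrow> bool" where
  "gl_map sg sv \<rho> \<longleftrightarrow> (\<forall>x. \<rho> x \<in> gl sv) \<and> Vector_Spaces.linear sg (op_scale sv) \<rho>"

definition tensor2_gl_map ::
  "('k::field \<Rightarrow> 'g::ab_group_add \<Rightarrow> 'g) \<Rightarrow> ('k \<Rightarrow> 'v::ab_group_add \<Rightarrow> 'v) \<Rightarrow>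
   ('g \<Rightarrow> 'g \<Rightarrow> 'v \<Rightarrow> 'v) \<Rightarrow> bool" where
  "tensor2_gl_map sg sv \<mu> \<longleftrightarrow>
     (\<forall>x y. \<mu> x y \<in> gl sv) \<and> bilinear_map sg sg (op_scale sv) \<mu>"

locale lie_yamaguti_algebra =
  fixes sg :: "'k::field_char_0 \<Rightarrow> 'g::ab_group_add \<Rightarrow> 'g"
    and br :: "'g \<Rightarrow> 'g \<Rightarrow> 'g"
    and tr :: "'g \<Rightarrow> 'g \<Rightarrow> 'g \<Rightarrow> 'g"
  assumes fin_dim_alg: "fin_dim_vs sg"
    and br_map: "wedge2_map sg br"
    and tr_map: "wedge2_tensor_map sg tr"
    and LY1: "br (br x y) z + br (br y z) x + br (br z x) y + tr x y z + tr y z x + tr z x y = 0"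
    and LY2: "tr (br x y) z w + tr (br y z) x w + tr (br z x) y w = 0"
    and LY3: "tr x y (br z w) = br (tr x y z) w + br z (tr x y w)"
    and LY4: "tr x y (tr z w t) = tr (tr x y z) w t + tr z (tr x y w) t + tr z w (tr x y t)"

definition rep_D ::
  "('g \<Rightarrow> 'g \<Rightarrow> 'g) \<Rightarrow> ('g \<Rightarrow> 'v::ab_group_add \<Rightarrow> 'v) \<Rightarrow> ('g \<Rightarrow> 'g \<Rightarrow> 'v \<Rightarrow> 'v) \<Rightarrow>
   'g \<Rightarrow> 'g \<Rightarrow> 'v \<Rightarrow> 'v" where
  "rep_D br \<rho> \<mu> x y = \<mu> y x - \<mu> x y + commutator (\<rho> x) (\<rho> y) - \<rho> (br x y)"

locale lieyrep_pair = lie_yamaguti_algebra sg br tr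
  for sg :: "'k::field_char_0 \<Rightarrow> 'g::ab_group_add \<Rightarrow> 'g" and br tr +
  fixes sv :: "'k \<Rightarrow> 'v::ab_group_add \<Rightarrow> 'v"
    and \<rho> :: "'g \<Rightarrow> 'v \<Rightarrow> 'v"
    and \<mu> :: "'g \<Rightarrow> 'g \<Rightarrow> 'v \<Rightarrow> 'v"
  assumes fin_dim_rep: "fin_dim_vs sv"
    and rho_map: "gl_map sg sv \<rho>"
    and mu_map: "tensor2_gl_map sg sv \<mu>"
    and rep1: "\<mu> (br x y) z - (\<mu> x z \<circ> \<rho> y) + (\<mu> y z \<circ> \<rho> x) = 0"
    and rep2: "\<mu> x (br y z) - (\<rho> y \<circ> \<mu> x z) + (\<rho> z \<circ> \<mu> x y) = 0"
    and rep3: "\<rho> (tr x y z) = commutator (rep_D br \<rho> \<mu> x y) (\<rho> z)"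
    and rep4: "(\<mu> z w \<circ> \<mu> x y) - (\<mu> y w \<circ> \<mu> x z) - \<mu> x (tr y z w)
                 + (rep_D br \<rho> \<mu> y z \<circ> \<mu> x w) = 0"
    and rep5: "\<mu> (tr x y z) w + \<mu> z (tr x y w) = commutator (rep_D br \<rho> \<mu> x y) (\<mu> z w)"

definition nij_phi ::
  "('g::ab_group_add \<Rightarrow> 'g \<Rightarrow> 'g) \<Rightarrow> ('g \<Rightarrow> 'g) \<Rightarrow> 'g \<Rightarrow> 'g \<Rightarrow> 'g" where
  "nij_phi br N x y = br (N x) y + br x (N y) - N (br x y)"

definition nij_phi1 ::
  "('g::ab_group_add \<Rightarrow> 'g \<Rightarrow> 'g \<Rightarrow> 'g) \<Rightarrow> ('g \<Rightarrow> 'g) \<Rightarrow> 'g \<Rightarrow> 'g \<Rightarrow> 'g \<Rightarrow> 'g" where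
  "nij_phi1 tr N x y z = tr (N x) y z + tr x (N y) z + tr x y (N z) - N (tr x y z)"

definition nij_phi2 ::
  "('g::ab_group_add \<Rightarrow> 'g \<Rightarrow> 'g \<Rightarrow> 'g) \<Rightarrow> ('g \<Rightarrow> 'g) \<Rightarrow> 'g \<Rightarrow> 'g \<Rightarrow> 'g \<Rightarrow> 'g" where
  "nij_phi2 tr N x y z =
     tr (N x) (N y) z + tr x (N y) (N z) + tr (N x) y (N z) - N (nij_phi1 tr N x y z)"

definition nij_rho ::
  "('g \<Rightarrow> 'v::ab_group_add \<Rightarrow> 'v) \<Rightarrow> ('g \<Rightarrow> 'g) \<Rightarrow> ('v \<Rightarrow> 'v) \<Rightarrow> 'g \<Rightarrow> 'v \<Rightarrow> 'v" where
  "nij_rho \<rho> N S x = \<rho> (N x) + (\<rho> x \<circ> S) - (S \<circ> \<rho> x)"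

definition nij_mu1 ::
  "('g \<Rightarrow> 'g \<Rightarrow> 'v::ab_group_add \<Rightarrow> 'v) \<Rightarrow> ('g \<Rightarrow> 'g) \<Rightarrow> ('v \<Rightarrow> 'v) \<Rightarrow>
   'g \<Rightarrow> 'g \<Rightarrow> 'v \<Rightarrow> 'v" where
  "nij_mu1 \<mu> N S x y = \<mu> (N x) y + \<mu> x (N y) + (\<mu> x y \<circ> S) - (S \<circ> \<mu> x y)"

definition nij_mu2 ::
  "('g \<Rightarrow> 'g \<Rightarrow> 'v::ab_group_add \<Rightarrow> 'v) \<Rightarrow> ('g \<Rightarrow> 'g) \<Rightarrow> ('v \<Rightarrow> 'v) \<Rightarrow>
   'g \<Rightarrow> 'g \<Rightarrow> 'v \<Rightarrow> 'v" where
  "nij_mu2 \<mu> N S x y =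
     (\<mu> (N x) y \<circ> S) + (\<mu> x (N y) \<circ> S) + \<mu> (N x) (N y) - (S \<circ> nij_mu1 \<mu> N S x y)"

definition nijenhuis_structure ::
  "('k::field_char_0 \<Rightarrow> 'g::ab_group_add \<Rightarrow> 'g) \<Rightarrow> ('g \<Rightarrow> 'g \<Rightarrow> 'g) \<Rightarrow> ('g \<Rightarrow> 'g \<Rightarrow> 'g \<Rightarrow> 'g) \<Rightarrow>
   ('k \<Rightarrow> 'v::ab_group_add \<Rightarrow> 'v) \<Rightarrow> ('g \<Rightarrow> 'v \<Rightarrow> 'v) \<Rightarrow> ('g \<Rightarrow> 'g \<Rightarrow> 'v \<Rightarrow> 'v) \<Rightarrow>
   ('g \<Rightarrow> 'g) \<Rightarrow> ('v \<Rightarrow> 'v) \<Rightarrow> bool" where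
  "nijenhuis_structure sg br tr sv \<rho> \<mu> N S \<longleftrightarrow>
     N \<in> gl sg \<and> S \<in> gl sv \<and>
     (\<forall>x y. N (nij_phi br N x y) = br (N x) (N y)) \<and>
     (\<forall>x y z. N (nij_phi2 tr N x y z) = tr (N x) (N y) (N z)) \<and>
     (\<forall>x. \<rho> (N x) \<circ> S = S \<circ> nij_rho \<rho> N S x) \<and>
     (\<forall>x y. \<mu> (N x) (N y) \<circ> S = S \<circ> nij_mu2 \<mu> N S x y)"

definition deform_br ::
  "('k \<Rightarrow> 'g::ab_group_add \<Rightarrow> 'g) \<Rightarrow> ('g \<Rightarrow> 'g \<Rightarrow> 'g) \<Rightarrow> ('g \<Rightarrow> 'g \<Rightarrow> 'g) \<Rightarrow>
   'k \<Rightarrow> 'g \<Rightarrow> 'g \<Rightarrow> 'g" where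
  "deform_br sg br \<phi> t x y = br x y + sg t (\<phi> x y)"

definition deform_tr ::
  "('k::field \<Rightarrow> 'g::ab_group_add \<Rightarrow> 'g) \<Rightarrow> ('g \<Rightarrow> 'g \<Rightarrow> 'g \<Rightarrow> 'g) \<Rightarrow>
   ('g \<Rightarrow> 'g \<Rightarrow> 'g \<Rightarrow> 'g) \<Rightarrow> ('g \<Rightarrow> 'g \<Rightarrow> 'g \<Rightarrow> 'g) \<Rightarrow> 'k \<Rightarrow> 'g \<Rightarrow> 'g \<Rightarrow> 'g \<Rightarrow> 'g" where
  "deform_tr sg tr \<phi>1 \<phi>2 t x y z = tr x y z + sg t (\<phi>1 x y z) + sg (t ^ 2) (\<phi>2 x y z)"

definition deform_rho ::
  "('k \<Rightarrow> 'v::ab_group_add \<Rightarrow> 'v) \<Rightarrow> ('g \<Rightarrow> 'v \<Rightarrow> 'v) \<Rightarrow> ('g \<Rightarrow> 'v \<Rightarrow> 'v) \<Rightarrow>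
   'k \<Rightarrow> 'g \<Rightarrow> 'v \<Rightarrow> 'v" where
  "deform_rho sv \<rho> \<rho>1 t x = \<rho> x + op_scale sv t (\<rho>1 x)"

definition deform_mu ::
  "('k::field \<Rightarrow> 'v::ab_group_add \<Rightarrow> 'v) \<Rightarrow> ('g \<Rightarrow> 'g \<Rightarrow> 'v \<Rightarrow> 'v) \<Rightarrow>
   ('g \<Rightarrow> 'g \<Rightarrow> 'v \<Rightarrow> 'v) \<Rightarrow> ('g \<Rightarrow> 'g \<Rightarrow> 'v \<Rightarrow> 'v) \<Rightarrow> 'k \<Rightarrow> 'g \<Rightarrow> 'g \<Rightarrow> 'v \<Rightarrow> 'v" where
  "deform_mu sv \<mu> \<mu>1 \<mu>2 t x y = \<mu> x y + op_scale sv t (\<mu>1 x y) + op_scale sv (t ^ 2) (\<mu>2 x y)"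

definition generates_linear_deformation ::
  "('k::field_char_0 \<Rightarrow> 'g::ab_group_add \<Rightarrow> 'g) \<Rightarrow> ('g \<Rightarrow> 'g \<Rightarrow> 'g) \<Rightarrow> ('g \<Rightarrow> 'g \<Rightarrow> 'g \<Rightarrow> 'g) \<Rightarrow>
   ('k \<Rightarrow> 'v::ab_group_add \<Rightarrow> 'v) \<Rightarrow> ('g \<Rightarrow> 'v \<Rightarrow> 'v) \<Rightarrow> ('g \<Rightarrow> 'g \<Rightarrow> 'v \<Rightarrow> 'v) \<Rightarrow>
   ('g \<Rightarrow> 'g \<Rightarrow> 'g) \<Rightarrow> ('g \<Rightarrow> 'g \<Rightarrow> 'g \<Rightarrow> 'g) \<Rightarrow> ('g \<Rightarrow> 'g \<Rightarrow> 'g \<Rightarrow> 'g) \<Rightarrow>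
   ('g \<Rightarrow> 'v \<Rightarrow> 'v) \<Rightarrow> ('g \<Rightarrow> 'g \<Rightarrow> 'v \<Rightarrow> 'v) \<Rightarrow> ('g \<Rightarrow> 'g \<Rightarrow> 'v \<Rightarrow> 'v) \<Rightarrow> bool" where
  "generates_linear_deformation sg br tr sv \<rho> \<mu> \<phi> \<phi>1 \<phi>2 \<rho>1 \<mu>1 \<mu>2 \<longleftrightarrow>
     wedge2_map sg \<phi> \<and> wedge2_tensor_map sg \<phi>1 \<and> wedge2_tensor_map sg \<phi>2 \<and>
     gl_map sg sv \<rho>1 \<and> tensor2_gl_map sg sv \<mu>1 \<and> tensor2_gl_map sg sv \<mu>2 \<and>
     (\<forall>t. lieyrep_pair sg (deform_br sg br \<phi> t) (deform_tr sg tr \<phi>1 \<phi>2 t)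
            sv (deform_rho sv \<rho> \<rho>1 t) (deform_mu sv \<mu> \<mu>1 \<mu>2 t))"

locale lieyrep_hom =
  source: lieyrep_pair sg br tr sv \<rho> \<mu> + target: lieyrep_pair sh br' tr' sw \<rho>' \<mu>'
  for sg :: "'k::field_char_0 \<Rightarrow> 'g::ab_group_add \<Rightarrow> 'g" and br tr
    and sv :: "'k \<Rightarrow> 'v::ab_group_add \<Rightarrow> 'v" and \<rho> \<mu>
    and sh :: "'k \<Rightarrow> 'h::ab_group_add \<Rightarrow> 'h" and br' tr'
    and sw :: "'k \<Rightarrow> 'w::ab_group_add \<Rightarrow> 'w" and \<rho>' \<mu>' +
  fixes \<alpha> :: "'g \<Rightarrow> 'h" and \<beta> :: "'v \<Rightarrow> 'w"
  assumes linear_alpha: "Vector_Spaces.linear sg sh \<alpha>"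
    and linear_beta: "Vector_Spaces.linear sv sw \<beta>"
    and hom_br: "\<alpha> (br x y) = br' (\<alpha> x) (\<alpha> y)"
    and hom_tr: "\<alpha> (tr x y z) = tr' (\<alpha> x) (\<alpha> y) (\<alpha> z)"
    and hom_rho: "\<beta> (\<rho> x v) = \<rho>' (\<alpha> x) (\<beta> v)"
    and hom_mu: "\<beta> (\<mu> x y v) = \<mu>' (\<alpha> x) (\<alpha> y) (\<beta> v)"

text \<open>
  Triviality asks for a homomorphism for every \<open>t\<close>, without exception; for those \<open>t\<close> at which both
  maps are invertible it is then an isomorphism.
\<close>

definition trivial_linear_deformation ::
  "('k::field_char_0 \<Rightarrow> 'g::ab_group_add \<Rightarrow> 'g) \<Rightarrow> ('g \<Rightarrow> 'g \<Rightarrow> 'g) \<Rightarrow> ('g \<Rightarrow> 'g \<Rightarrow> 'g \<Rightarrow> 'g) \<Rightarrow>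
   ('k \<Rightarrow> 'v::ab_group_add \<Rightarrow> 'v) \<Rightarrow> ('g \<Rightarrow> 'v \<Rightarrow> 'v) \<Rightarrow> ('g \<Rightarrow> 'g \<Rightarrow> 'v \<Rightarrow> 'v) \<Rightarrow>
   ('g \<Rightarrow> 'g \<Rightarrow> 'g) \<Rightarrow> ('g \<Rightarrow> 'g \<Rightarrow> 'g \<Rightarrow> 'g) \<Rightarrow> ('g \<Rightarrow> 'g \<Rightarrow> 'g \<Rightarrow> 'g) \<Rightarrow>
   ('g \<Rightarrow> 'v \<Rightarrow> 'v) \<Rightarrow> ('g \<Rightarrow> 'g \<Rightarrow> 'v \<Rightarrow> 'v) \<Rightarrow> ('g \<Rightarrow> 'g \<Rightarrow> 'v \<Rightarrow> 'v) \<Rightarrow> bool" where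
  "trivial_linear_deformation sg br tr sv \<rho> \<mu> \<phi> \<phi>1 \<phi>2 \<rho>1 \<mu>1 \<mu>2 \<longleftrightarrow>
     (\<exists>N'\<in>gl sg. \<exists>S'\<in>gl sv. \<forall>t.
        lieyrep_hom sg (deform_br sg br \<phi> t) (deform_tr sg tr \<phi>1 \<phi>2 t)
          sv (deform_rho sv \<rho> \<rho>1 t) (deform_mu sv \<mu> \<mu>1 \<mu>2 t)
          sg br tr sv \<rho> \<mu>
          (id + op_scale sg t N') (id + op_scale sv t S'))"

end

theory Submission imports Defs "HOL-Computational_Algebra.Polynomial" begin

text \<open>
  Put \<open>\<alpha>\<^sub>t = Id + t N\<close> and \<open>\<beta>\<^sub>t = Id + t S\<close>.  Comparing powers of \<open>t\<close>, the six defining formulas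
  together with the four Nijenhuis equations say exactly that \<open>(\<alpha>\<^sub>t, \<beta>\<^sub>t)\<close> intertwines the deformed
  operations with the original ones, for example \<open>\<alpha>\<^sub>t [x, y]\<^sub>t = [\<alpha>\<^sub>t x, \<alpha>\<^sub>t y]\<close>.  This is the
  triviality of the deformation as soon as the deformed data are known to form a LieYRep pair.

  The axioms of a LieYRep pair follow from the same intertwining relations.  Let \<open>f(t) = 0\<close> be one of
  the axioms for the deformed operations, at fixed arguments.  Pushing \<open>\<alpha>\<^sub>t\<close> (or \<open>\<beta>\<^sub>t\<close>) through
  \<open>f(t)\<close> produces the same axiom for the original operations, at arguments transported by \<open>\<alpha>\<^sub>t\<close>
  and \<open>\<beta>\<^sub>t\<close>, so \<open>\<alpha>\<^sub>t (f(t)) = 0\<close> for every \<open>t\<close>.  It remains to cancel \<open>\<alpha>\<^sub>t\<close>, although it may be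
  singular for some \<open>t\<close>.  Now \<open>f\<close> is a polynomial in \<open>t\<close> with vector coefficients \<open>c\<^sub>0, c\<^sub>1, \<dots>\<close>;
  over an infinite field \<open>(Id + t N) f(t) = 0\<close> gives \<open>c\<^sub>0 = 0\<close> and \<open>c\<^sub>i\<^sub>+\<^sub>1 = - N c\<^sub>i\<close>, hence \<open>f = 0\<close>.
  This cancellation is \<open>vpoly_cancel\<close>.  It replaces the explicit expansion of every axiom in
  powers of \<open>t\<close>.
\<close>

section \<open>Polynomial functions with vector coefficients\<close>

text \<open>
  These are the functions \<open>t \<mapsto> c\<^sub>0 + t c\<^sub>1 + \<dots> + t\<^sup>n c\<^sub>n\<close>.  The Horner form turns every closure
  property below into a short induction without double sums.
\<close>

inductive vpoly :: "('k::field \<Rightarrow> 'v::ab_group_add \<Rightarrow> 'v) \<Rightarrow> ('k \<Rightarrow> 'v) \<Rightarrow> bool"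
  for s :: "'k \<Rightarrow> 'v \<Rightarrow> 'v" where
  const: "vpoly s (\<lambda>t. v)"
| horner: "vpoly s f \<Longrightarrow> vpoly s (\<lambda>t. v + s t (f t))"

lemma linearD:
  assumes "Vector_Spaces.linear s1 s2 f"
  shows "f (x + y) = f x + f y" "f (s1 c x) = s2 c (f x)" "f (x - y) = f x - f y"
    "f 0 = 0"
proof -
  interpret Vector_Spaces.linear s1 s2 f by fact
  show "f (x + y) = f x + f y" "f (s1 c x) = s2 c (f x)" "f (x - y) = f x - f y"
    "f 0 = 0"
    by (simp_all add: add scale diff)
qed

lemma linearI:
  assumes "vector_space s1" "vector_space s2"
    and "\<And>x y. f (x + y) = f x + f y" "\<And>c x. f (s1 c x) = s2 c (f x)"
  shows "Vector_Spaces.linear s1 s2 f"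
  using assms by (simp add: Vector_Spaces.linear_iff)

lemma vpoly_linear:
  assumes "Vector_Spaces.linear s1 s2 l" and "vpoly s1 f"
  shows "vpoly s2 (\<lambda>t. l (f t))"
  using assms(2) by induction (auto simp: linearD[OF assms(1)] intro: vpoly.intros)

context vector_space
begin

lemma vpoly_scale: "vpoly scale f \<Longrightarrow> vpoly scale (\<lambda>t. scale t (f t))"
  using vpoly.horner[of scale f 0] by simp

lemma vpoly_scale2: "vpoly scale f \<Longrightarrow> vpoly scale (\<lambda>t. scale (t ^ 2) (f t))"
  using vpoly_scale[OF vpoly_scale, of f] by (simp add: power2_eq_square)

lemma vpoly_add:
  assumes "vpoly scale f" and "vpoly scale g"
  shows "vpoly scale (\<lambda>t. f t + g t)"
  using assms
proof (induction arbitrary: g)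
  case (const v)
  from const.prems show ?case
  proof cases
    case (const w)
    then show ?thesis by (auto intro: vpoly.const)
  next
    case (horner g' w)
    then show ?thesis using vpoly.horner[of scale g' "v + w"] by (simp add: add.assoc)
  qed
next
  case (horner f v)
  from horner.prems show ?case
  proof cases
    case (const w)
    then show ?thesis using vpoly.horner[OF horner.hyps, of "v + w"] by (simp add: ac_simps)
  next
    case (horner g' w)
    then show ?thesis
      using vpoly.horner[OF horner.IH, of g' "v + w"] by (simp add: scale_right_distrib ac_simps)
  qed
qed

lemma vpoly_uminus: "vpoly scale f \<Longrightarrow> vpoly scale (\<lambda>t. - f t)"
  by (rule vpoly_linear[OF linearI]) (simp_all add: vector_space_axioms)

lemma vpoly_diff:
  "vpoly scale f \<Longrightarrow> vpoly scale g \<Longrightarrow> vpoly scale (\<lambda>t. f t - g t)"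
  using vpoly_add[OF _ vpoly_uminus, of f g] by simp

end

lemma vpoly_bilinear:
  assumes lin: "\<And>y. Vector_Spaces.linear s1 s3 (\<lambda>x. b x y)" "\<And>x. Vector_Spaces.linear s2 s3 (b x)"
    and f: "vpoly s1 f" and g: "vpoly s2 g"
  shows "vpoly s3 (\<lambda>t. b (f t) (g t))"
proof -
  interpret vector_space s3 using lin(1) by (simp add: Vector_Spaces.linear_iff)
  show ?thesis
    using f by induction
      (auto simp: linearD[OF lin(1)] intro: vpoly_linear[OF lin(2) g] vpoly_add vpoly_scale)
qed

lemma vpoly_trilinear:
  assumes lin: "\<And>y z. Vector_Spaces.linear s1 s4 (\<lambda>x. m x y z)"
      "\<And>x z. Vector_Spaces.linear s2 s4 (\<lambda>y. m x y z)" "\<And>x y. Vector_Spaces.linear s3 s4 (m x y)"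
    and f: "vpoly s1 f" and g: "vpoly s2 g" and h: "vpoly s3 h"
  shows "vpoly s4 (\<lambda>t. m (f t) (g t) (h t))"
proof -
  interpret vector_space s4 using lin(1) by (simp add: Vector_Spaces.linear_iff)
  show ?thesis
    using f by induction
      (auto simp: linearD[OF lin(1)] intro: vpoly_bilinear[OF lin(2,3) g h] vpoly_add vpoly_scale)
qed

text \<open>
  The coordinates of a vector polynomial in a basis are ordinary polynomials, and these have
  finitely many roots, while the field, being of characteristic 0, is infinite.
\<close>

lemma vpoly_eq_0_if_eq_0_off_0:
  fixes s :: "'k::field_char_0 \<Rightarrow> 'v::ab_group_add \<Rightarrow> 'v"
  assumes "vector_space s" and f: "vpoly s f" and zero: "\<And>t. t \<noteq> 0 \<Longrightarrow> f t = 0"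
  shows "f t = 0"
proof -
  interpret vector_space s by fact
  define B where "B = extend_basis {}"
  have B: "independent B" "span B = UNIV"
    by (simp_all add: B_def independent_extend_basis independent_empty)
  have "representation B (f t) b = 0" for b
  proof -
    from f have "\<exists>p. \<forall>t. representation B (f t) b = poly p t"
    proof induction
      case (const v)
      show ?case by (rule exI[of _ "[:representation B v b:]"]) simp
    next
      case (horner f v)
      then obtain p where "\<forall>t. representation B (f t) b = poly p t" by blast
      then show ?case
        by (intro exI[of _ "pCons (representation B v b) p"])
          (simp add: representation_add representation_scale B)
    qed
    then obtain p where p: "\<And>t. representation B (f t) b = poly p t" by blast
    have "- {0} \<subseteq> {t. poly p t = 0}"
      using zero by (auto simp: p[symmetric] representation_zero)
    moreover have "infinite (- {0 :: 'k})"
      by (simp add: infinite_UNIV_char_0 Compl_eq_Diff_UNIV)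
    ultimately have "p = 0"
      using poly_roots_finite[of p] finite_subset by blast
    then show ?thesis by (simp add: p)
  qed
  then have "representation B (f t) = representation B 0"
    by (auto simp: representation_zero)
  then show ?thesis
    using sum_nonzero_representation_eq[OF B(1), of "f t"] B(2) by (simp add: representation_zero)
qed

text \<open>
  The constant coefficient of \<open>f\<close> vanishes by evaluation at \<open>t = 0\<close>.  Then \<open>f(t) = t f'(t)\<close>, and
  dividing by \<open>t\<close> leaves the same equation for \<open>f'\<close>, at first for \<open>t \<noteq> 0\<close> only.
\<close>

lemma vpoly_cancel:
  fixes s :: "'k::field_char_0 \<Rightarrow> 'v::ab_group_add \<Rightarrow> 'v"
  assumes lin: "Vector_Spaces.linear s s N" and f: "vpoly s f"
    and zero: "\<And>t. f t + s t (N (f t)) = 0"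
  shows "f t = 0"
proof -
  interpret vector_space s using lin by (simp add: Vector_Spaces.linear_iff)
  show ?thesis
    using f zero
  proof (induction arbitrary: t)
    case (const v)
    from const[of 0] show ?case by simp
  next
    case (horner f v)
    from horner.prems[of 0] have v: "v = 0" by simp
    have "f t + s t (N (f t)) = 0" if "t \<noteq> 0" for t
    proof -
      have "s t (f t + s t (N (f t))) = 0"
        using horner.prems[of t] by (simp add: v linearD[OF lin] scale_right_distrib)
      then show ?thesis using that by simp
    qed
    moreover have "vpoly s (\<lambda>t. f t + s t (N (f t)))"
      by (intro vpoly_add vpoly_scale vpoly_linear[OF lin] horner.hyps)
    ultimately have "f t + s t (N (f t)) = 0" for t
      using vpoly_eq_0_if_eq_0_off_0[OF vector_space_axioms] by blast
    from horner.IH[OF this] show ?case by (simp add: v)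
  qed
qed

corollary vpoly_cancel_eq:
  fixes s :: "'k::field_char_0 \<Rightarrow> 'v::ab_group_add \<Rightarrow> 'v"
  assumes lin: "Vector_Spaces.linear s s N" and "vpoly s f" "vpoly s g"
    and eq: "\<And>t. (id + op_scale s t N) (f t) = (id + op_scale s t N) (g t)"
  shows "f t = g t"
proof -
  interpret vector_space s using lin by (simp add: Vector_Spaces.linear_iff)
  have "f t + s t (N (f t)) = g t + s t (N (g t))" for t
    using eq[of t] by (simp add: op_scale_def)
  then have "(f t - g t) + s t (N (f t - g t)) = 0" for t
    by (simp add: linearD[OF lin] scale_right_diff_distrib algebra_simps)
  then have "f t - g t = 0"
    by (intro vpoly_cancel[OF lin vpoly_diff[OF assms(2,3)]])
  then show ?thesis by simp
qed

section \<open>The operations of a LieYRep pair in each argument\<close>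

context lieyrep_pair
begin

sublocale alg: vector_space sg
  using fin_dim_alg by (auto simp: fin_dim_vs_def finite_dimensional_vector_space_def)

sublocale rep: vector_space sv
  using fin_dim_rep by (auto simp: fin_dim_vs_def finite_dimensional_vector_space_def)

lemma br_linear: "Vector_Spaces.linear sg sg (\<lambda>x. br x y)" "Vector_Spaces.linear sg sg (br x)"
  using br_map by (auto simp: wedge2_map_def bilinear_map_def)

lemma tr_linear:
  "Vector_Spaces.linear sg sg (\<lambda>x. tr x y z)"
  "Vector_Spaces.linear sg sg (\<lambda>y. tr x y z)"
  "Vector_Spaces.linear sg sg (tr x y)"
  using tr_map by (auto simp: wedge2_tensor_map_def)

lemma rho_linear:
  "Vector_Spaces.linear sg sv (\<lambda>x. \<rho> x v)" "Vector_Spaces.linear sv sv (\<rho> x)"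
  using rho_map alg.vector_space_axioms rep.vector_space_axioms
  by (auto simp: gl_map_def gl_def Vector_Spaces.linear_iff op_scale_def)

lemma mu_linear:
  "Vector_Spaces.linear sg sv (\<lambda>x. \<mu> x y v)" "Vector_Spaces.linear sg sv (\<lambda>y. \<mu> x y v)"
  "Vector_Spaces.linear sv sv (\<mu> x y)"
  using mu_map alg.vector_space_axioms rep.vector_space_axioms
  by (auto simp: tensor2_gl_map_def bilinear_map_def gl_def Vector_Spaces.linear_iff op_scale_def)

lemmas multilinear =
  br_linear[THEN linearD(1)] br_linear[THEN linearD(2)] br_linear[THEN linearD(3)]
  tr_linear[THEN linearD(1)] tr_linear[THEN linearD(2)] tr_linear[THEN linearD(3)]
  rho_linear[THEN linearD(1)] rho_linear[THEN linearD(2)] rho_linear[THEN linearD(3)]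
  mu_linear[THEN linearD(1)] mu_linear[THEN linearD(2)] mu_linear[THEN linearD(3)]

lemma br_self: "br x x = 0"
  using br_map by (simp add: wedge2_map_def)

lemma tr_self: "tr x x z = 0"
  using tr_map by (simp add: wedge2_tensor_map_def)

lemma br_skew: "br y x = - br x y"
  using br_self[of "y + x", unfolded multilinear]
    by (simp add: br_self eq_neg_iff_add_eq_0 add.commute)

lemma tr_skew: "tr y x z = - tr x y z"
  using tr_self[of "y + x" z, unfolded multilinear]
    by (simp add: tr_self eq_neg_iff_add_eq_0 add.commute)

end

section \<open>The deformation defined by a Nijenhuis structure\<close>

locale nijenhuis_pair = lieyrep_pair sg br tr sv \<rho> \<mu>
  for sg :: "'k::field_char_0 \<Rightarrow> 'g::ab_group_add \<Rightarrow> 'g" and br tr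
    and sv :: "'k \<Rightarrow> 'v::ab_group_add \<Rightarrow> 'v" and \<rho> \<mu> +
  fixes N :: "'g \<Rightarrow> 'g" and S :: "'v \<Rightarrow> 'v"
  assumes nijenhuis: "nijenhuis_structure sg br tr sv \<rho> \<mu> N S"
begin

lemma N_linear: "Vector_Spaces.linear sg sg N" and S_linear: "Vector_Spaces.linear sv sv S"
  using nijenhuis by (auto simp: nijenhuis_structure_def gl_def)

lemmas NS_linear = N_linear[THEN linearD(1)] N_linear[THEN linearD(2)] N_linear[THEN linearD(3)]
  N_linear[THEN linearD(4)]
  S_linear[THEN linearD(1)] S_linear[THEN linearD(2)] S_linear[THEN linearD(3)]

lemma nijenhuis_eqs:
  "N (nij_phi br N x y) = br (N x) (N y)"
  "N (nij_phi2 tr N x y z) = tr (N x) (N y) (N z)"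
  "S (nij_rho \<rho> N S x v) = \<rho> (N x) (S v)"
  "S (nij_mu2 \<mu> N S x y v) = \<mu> (N x) (N y) (S v)"
  using nijenhuis by (simp_all add: nijenhuis_structure_def fun_eq_iff)

definition "brt = deform_br sg br (nij_phi br N)"
definition "trt = deform_tr sg tr (nij_phi1 tr N) (nij_phi2 tr N)"
definition "rhot = deform_rho sv \<rho> (nij_rho \<rho> N S)"
definition "mut = deform_mu sv \<mu> (nij_mu1 \<mu> N S) (nij_mu2 \<mu> N S)"
definition "\<alpha> t = id + op_scale sg t N"
definition "\<beta> t = id + op_scale sv t S"

lemma alpha_linear: "Vector_Spaces.linear sg sg (\<alpha> t)"
  by (rule linearI) (auto simp: \<alpha>_def op_scale_def NS_linear alg.scale_right_distrib
      alg.vector_space_axioms mult.commute)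

lemma beta_linear: "Vector_Spaces.linear sv sv (\<beta> t)"
  by (rule linearI) (auto simp: \<beta>_def op_scale_def NS_linear rep.scale_right_distrib
      rep.vector_space_axioms mult.commute)

lemmas hom_linear =
  alpha_linear[THEN linearD(1)] alpha_linear[THEN linearD(3)] alpha_linear[THEN linearD(4)]
  beta_linear[THEN linearD(1)] beta_linear[THEN linearD(3)] beta_linear[THEN linearD(4)]

subsection \<open>Multilinearity\<close>

text \<open>
  For the alternating property, skew-symmetry is used only in the form \<open>[x, N x] = - [N x, x]\<close>, which
  is a terminating rewrite rule.
\<close>

lemma nij_phi_map: "wedge2_map sg (nij_phi br N)"
  unfolding wedge2_map_def bilinear_map_def nij_phi_def
  by (intro conjI allI linearI alg.vector_space_axioms)
    (simp_all add: multilinear NS_linear alg.scale_right_distrib alg.scale_right_diff_distrib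
      br_self br_skew[of "N x" x for x])

lemma nij_phi1_map: "wedge2_tensor_map sg (nij_phi1 tr N)"
  unfolding wedge2_tensor_map_def nij_phi1_def
  by (intro conjI allI linearI alg.vector_space_axioms)
    (simp_all add: multilinear NS_linear alg.scale_right_distrib alg.scale_right_diff_distrib
      tr_self tr_skew[of "N x" x for x])

lemma nij_phi2_map: "wedge2_tensor_map sg (nij_phi2 tr N)"
  using nij_phi1_map
  unfolding wedge2_tensor_map_def nij_phi2_def
  by (intro conjI allI linearI alg.vector_space_axioms)
    (simp_all add: multilinear NS_linear alg.scale_right_distrib alg.scale_right_diff_distrib
      tr_self tr_skew[of "N x" x for x] Vector_Spaces.linear_iff)

lemma nij_rho_map: "gl_map sg sv (nij_rho \<rho> N S)"
  unfolding gl_map_def gl_def mem_Collect_eq nij_rho_def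
  by (intro conjI allI linearI alg.vector_space_axioms rep.vector_space_axioms
      vector_space_op_scale)
    (simp_all add: fun_eq_iff op_scale_def multilinear NS_linear rep.scale_right_distrib
      rep.scale_right_diff_distrib)

lemma nij_mu1_map: "tensor2_gl_map sg sv (nij_mu1 \<mu> N S)"
  unfolding tensor2_gl_map_def bilinear_map_def gl_def mem_Collect_eq nij_mu1_def
  by (intro conjI allI linearI alg.vector_space_axioms rep.vector_space_axioms
      vector_space_op_scale)
    (simp_all add: fun_eq_iff op_scale_def multilinear NS_linear rep.scale_right_distrib
      rep.scale_right_diff_distrib)

lemma nij_mu2_map: "tensor2_gl_map sg sv (nij_mu2 \<mu> N S)"
  using nij_mu1_map
  unfolding tensor2_gl_map_def bilinear_map_def gl_def mem_Collect_eq nij_mu2_def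
  by (intro conjI allI linearI alg.vector_space_axioms rep.vector_space_axioms
      vector_space_op_scale)
    (simp_all add: fun_eq_iff op_scale_def multilinear NS_linear rep.scale_right_distrib
      rep.scale_right_diff_distrib Vector_Spaces.linear_iff)

lemma brt_map: "wedge2_map sg (brt t)"
  using nij_phi_map br_map
  by (simp add: brt_def deform_br_def wedge2_map_def bilinear_map_def Vector_Spaces.linear_iff
      alg.scale_right_distrib mult.commute)

lemma trt_map: "wedge2_tensor_map sg (trt t)"
  using nij_phi1_map nij_phi2_map tr_map
  by (simp add: trt_def deform_tr_def wedge2_tensor_map_def Vector_Spaces.linear_iff
      alg.scale_right_distrib mult.commute)

lemma rhot_map: "gl_map sg sv (rhot t)"
  using nij_rho_map rho_map
  by (simp add: rhot_def deform_rho_def gl_map_def gl_def Vector_Spaces.linear_iff op_scale_def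
      fun_eq_iff rep.scale_right_distrib mult.commute)

lemma mut_map: "tensor2_gl_map sg sv (mut t)"
  using nij_mu1_map nij_mu2_map mu_map
  by (simp add: mut_def deform_mu_def tensor2_gl_map_def bilinear_map_def gl_def
      Vector_Spaces.linear_iff op_scale_def fun_eq_iff rep.scale_right_distrib mult.commute)

subsection \<open>Intertwining relations\<close>

text \<open>
  In each relation the two sides are polynomials in \<open>t\<close>.  The coefficients below the top degree
  agree by the defining formulas of the deformation, and those of top degree by a Nijenhuis
  equation.
\<close>

lemma alpha_brt: "\<alpha> t (brt t x y) = br (\<alpha> t x) (\<alpha> t y)"
proof -
  have "\<alpha> t (brt t x y) = br x y + sg t (nij_phi br N x y + N (br x y))
      + sg (t ^ 2) (N (nij_phi br N x y))"
    by (simp add: \<alpha>_def brt_def deform_br_def op_scale_def NS_linear alg.scale_right_distrib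
        power2_eq_square)
  also have "\<dots> = br (\<alpha> t x) (\<alpha> t y)"
    unfolding nijenhuis_eqs
    by (simp add: nij_phi_def \<alpha>_def op_scale_def multilinear alg.scale_right_distrib
        power2_eq_square)
  finally show ?thesis .
qed

lemma alpha_trt: "\<alpha> t (trt t x y z) = tr (\<alpha> t x) (\<alpha> t y) (\<alpha> t z)"
proof -
  have "\<alpha> t (trt t x y z) = tr x y z + sg t (nij_phi1 tr N x y z + N (tr x y z))
      + sg (t ^ 2) (nij_phi2 tr N x y z + N (nij_phi1 tr N x y z))
      + sg (t ^ 3) (N (nij_phi2 tr N x y z))"
    by (simp add: \<alpha>_def trt_def deform_tr_def op_scale_def NS_linear alg.scale_right_distrib
        power2_eq_square power3_eq_cube mult.assoc)
  also have "\<dots> = tr (\<alpha> t x) (\<alpha> t y) (\<alpha> t z)"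
    unfolding nijenhuis_eqs
    by (simp add: nij_phi1_def nij_phi2_def \<alpha>_def op_scale_def multilinear
        alg.scale_right_distrib power2_eq_square power3_eq_cube mult.assoc)
  finally show ?thesis .
qed

lemma beta_rhot: "\<beta> t (rhot t x v) = \<rho> (\<alpha> t x) (\<beta> t v)"
proof -
  have "\<beta> t (rhot t x v) = \<rho> x v + sv t (nij_rho \<rho> N S x v + S (\<rho> x v))
      + sv (t ^ 2) (S (nij_rho \<rho> N S x v))"
    by (simp add: \<beta>_def rhot_def deform_rho_def op_scale_def NS_linear rep.scale_right_distrib
        power2_eq_square)
  also have "\<dots> = \<rho> (\<alpha> t x) (\<beta> t v)"
    unfolding nijenhuis_eqs
    by (simp add: nij_rho_def \<alpha>_def \<beta>_def op_scale_def multilinear rep.scale_right_distrib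
        power2_eq_square)
  finally show ?thesis .
qed

lemma beta_mut: "\<beta> t (mut t x y v) = \<mu> (\<alpha> t x) (\<alpha> t y) (\<beta> t v)"
proof -
  have "\<beta> t (mut t x y v) = \<mu> x y v + sv t (nij_mu1 \<mu> N S x y v + S (\<mu> x y v))
      + sv (t ^ 2) (nij_mu2 \<mu> N S x y v + S (nij_mu1 \<mu> N S x y v))
      + sv (t ^ 3) (S (nij_mu2 \<mu> N S x y v))"
    by (simp add: \<beta>_def mut_def deform_mu_def op_scale_def NS_linear rep.scale_right_distrib
        power2_eq_square power3_eq_cube mult.assoc)
  also have "\<dots> = \<mu> (\<alpha> t x) (\<alpha> t y) (\<beta> t v)"
    unfolding nijenhuis_eqs
    by (simp add: nij_mu1_def nij_mu2_def \<alpha>_def \<beta>_def op_scale_def multilinear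
        rep.scale_right_distrib power2_eq_square power3_eq_cube mult.assoc)
  finally show ?thesis .
qed

lemma beta_rep_D:
  "\<beta> t (rep_D (brt t) (rhot t) (mut t) x y v) = rep_D br \<rho> \<mu> (\<alpha> t x) (\<alpha> t y) (\<beta> t v)"
  by (simp add: rep_D_def commutator_def hom_linear alpha_brt beta_rhot beta_mut)

lemmas intertwine = alpha_brt alpha_trt beta_rhot beta_mut beta_rep_D hom_linear

subsection \<open>Polynomial dependence on the parameter\<close>

lemmas vpoly_arith = vpoly.const alg.vpoly_add alg.vpoly_diff alg.vpoly_scale alg.vpoly_scale2
  rep.vpoly_add rep.vpoly_diff rep.vpoly_scale rep.vpoly_scale2

lemmas vpoly_ops = vpoly_bilinear[OF br_linear] vpoly_trilinear[OF tr_linear]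
  vpoly_bilinear[OF rho_linear] vpoly_trilinear[OF mu_linear]
  vpoly_linear[OF N_linear] vpoly_linear[OF S_linear]

lemma vpoly_brt:
  "vpoly sg f \<Longrightarrow> vpoly sg g \<Longrightarrow> vpoly sg (\<lambda>t. brt t (f t) (g t))"
  unfolding brt_def deform_br_def nij_phi_def
  by (intro vpoly_arith vpoly_ops)

lemma vpoly_trt:
  "vpoly sg f \<Longrightarrow> vpoly sg g \<Longrightarrow> vpoly sg h \<Longrightarrow> vpoly sg (\<lambda>t. trt t (f t) (g t) (h t))"
  unfolding trt_def deform_tr_def nij_phi2_def nij_phi1_def
  by (intro vpoly_arith vpoly_ops)

lemma vpoly_rhot:
  "vpoly sg f \<Longrightarrow> vpoly sv g \<Longrightarrow> vpoly sv (\<lambda>t. rhot t (f t) (g t))"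
  unfolding rhot_def deform_rho_def nij_rho_def op_scale_def plus_fun_apply fun_diff_def comp_def
  by (intro vpoly_arith vpoly_ops)

lemma vpoly_mut:
  "vpoly sg f \<Longrightarrow> vpoly sg g \<Longrightarrow> vpoly sv h \<Longrightarrow> vpoly sv (\<lambda>t. mut t (f t) (g t) (h t))"
  unfolding mut_def deform_mu_def nij_mu2_def nij_mu1_def op_scale_def plus_fun_apply fun_diff_def
    comp_def
  by (intro vpoly_arith vpoly_ops)

lemma vpoly_rep_D:
  "vpoly sg f \<Longrightarrow> vpoly sg g \<Longrightarrow> vpoly sv h \<Longrightarrow>
    vpoly sv (\<lambda>t. rep_D (brt t) (rhot t) (mut t) (f t) (g t) (h t))"
  unfolding rep_D_def commutator_def plus_fun_apply fun_diff_def comp_def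
  by (intro vpoly_arith vpoly_brt vpoly_rhot vpoly_mut)

lemmas vpoly_deformed = vpoly_arith vpoly_brt vpoly_trt vpoly_rhot vpoly_mut vpoly_rep_D

lemmas alg_cancel = vpoly_cancel_eq[OF N_linear, folded \<alpha>_def]
lemmas rep_cancel = vpoly_cancel_eq[OF S_linear, folded \<beta>_def]

subsection \<open>The deformed LieYRep pair\<close>

text \<open>
  Applied to both sides, \<open>\<alpha>\<^sub>t\<close> turns each axiom into the same axiom of the original algebra at the
  arguments \<open>\<alpha>\<^sub>t x, \<alpha>\<^sub>t y, \<dots>\<close>; both sides being polynomial in \<open>t\<close>, \<open>\<alpha>\<^sub>t\<close> can be cancelled.
\<close>

lemma deformed_algebra: "lie_yamaguti_algebra sg (brt t) (trt t)"
proof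
  fix x y z w u
  show "brt t (brt t x y) z + brt t (brt t y z) x + brt t (brt t z x) y
      + trt t x y z + trt t y z x + trt t z x y = 0"
    by (rule alg_cancel[where g = "\<lambda>t. 0"]; (intro vpoly_deformed)?) (simp add: intertwine LY1)
  show "trt t (brt t x y) z w + trt t (brt t y z) x w + trt t (brt t z x) y w = 0"
    by (rule alg_cancel[where g = "\<lambda>t. 0"]; (intro vpoly_deformed)?) (simp add: intertwine LY2)
  show "trt t x y (brt t z w) = brt t (trt t x y z) w + brt t z (trt t x y w)"
    by (rule alg_cancel; (intro vpoly_deformed)?) (simp add: intertwine LY3)
  show "trt t x y (trt t z w u)
      = trt t (trt t x y z) w u + trt t z (trt t x y w) u + trt t z w (trt t x y u)"
    \<comment> \<open>Fixing the outer pair as \<open>x, y\<close> keeps the axiom from rewriting its own last summand.\<close>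
    by (rule alg_cancel; (intro vpoly_deformed)?) (simp add: intertwine LY4[of "\<alpha> _ x" "\<alpha> _ y"])
qed (fact fin_dim_alg brt_map trt_map)+

text \<open>
  The same argument with \<open>\<beta>\<^sub>t\<close>, applied to the operator identities evaluated at a vector.
\<close>

lemma deformed_pair: "lieyrep_pair sg (brt t) (trt t) sv (rhot t) (mut t)"
proof -
  interpret dalg: lie_yamaguti_algebra sg "brt t" "trt t" by (rule deformed_algebra)
  note fun_simps = fun_eq_iff plus_fun_apply minus_apply comp_apply zero_fun_apply commutator_def
  show ?thesis
  proof
    fix x y z w
    show "mut t (brt t x y) z - (mut t x z \<circ> rhot t y) + (mut t y z \<circ> rhot t x) = 0"
      unfolding fun_simps
      using rep1[of "\<alpha> _ x" "\<alpha> _ y" "\<alpha> _ z", unfolded fun_simps]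
      by (intro allI, rule_tac rep_cancel[where g = "\<lambda>t. 0"]; (intro vpoly_deformed)?)
        (simp add: intertwine)
    show "mut t x (brt t y z) - (rhot t y \<circ> mut t x z) + (rhot t z \<circ> mut t x y) = 0"
      unfolding fun_simps
      using rep2[of "\<alpha> _ x" "\<alpha> _ y" "\<alpha> _ z", unfolded fun_simps]
      by (intro allI, rule_tac rep_cancel[where g = "\<lambda>t. 0"]; (intro vpoly_deformed)?)
        (simp add: intertwine)
    show "rhot t (trt t x y z)
        = commutator (rep_D (brt t) (rhot t) (mut t) x y) (rhot t z)"
      unfolding fun_simps
      using rep3[of "\<alpha> _ x" "\<alpha> _ y" "\<alpha> _ z", unfolded fun_simps]
      by (intro allI, rule_tac rep_cancel; (intro vpoly_deformed)?)
        (simp add: intertwine)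
    show "(mut t z w \<circ> mut t x y) - (mut t y w \<circ> mut t x z) - mut t x (trt t y z w)
        + (rep_D (brt t) (rhot t) (mut t) y z \<circ> mut t x w) = 0"
      unfolding fun_simps
      using rep4[of "\<alpha> _ z" "\<alpha> _ w" "\<alpha> _ x" "\<alpha> _ y", unfolded fun_simps]
      by (intro allI, rule_tac rep_cancel[where g = "\<lambda>t. 0"]; (intro vpoly_deformed)?)
        (simp add: intertwine)
    show "mut t (trt t x y z) w + mut t z (trt t x y w)
        = commutator (rep_D (brt t) (rhot t) (mut t) x y) (mut t z w)"
      unfolding fun_simps
      using rep5[of "\<alpha> _ x" "\<alpha> _ y" "\<alpha> _ z" "\<alpha> _ w", unfolded fun_simps]
      by (intro allI, rule_tac rep_cancel; (intro vpoly_deformed)?)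
        (simp add: intertwine)
  qed (fact fin_dim_rep rhot_map mut_map)+
qed

lemma deformed_hom:
  "lieyrep_hom sg (brt t) (trt t) sv (rhot t) (mut t) sg br tr sv \<rho> \<mu> (\<alpha> t) (\<beta> t)"
  by (intro lieyrep_hom.intro lieyrep_hom_axioms.intro deformed_pair lieyrep_pair_axioms
      alpha_linear beta_linear intertwine)

lemma generates_deformation:
  "generates_linear_deformation sg br tr sv \<rho> \<mu>
     (nij_phi br N) (nij_phi1 tr N) (nij_phi2 tr N)
     (nij_rho \<rho> N S) (nij_mu1 \<mu> N S) (nij_mu2 \<mu> N S)"
  unfolding generates_linear_deformation_def
  using nij_phi_map nij_phi1_map nij_phi2_map nij_rho_map nij_mu1_map nij_mu2_map deformed_pair
  by (simp add: brt_def trt_def rhot_def mut_def)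

lemma deformation_trivial:
  "trivial_linear_deformation sg br tr sv \<rho> \<mu>
     (nij_phi br N) (nij_phi1 tr N) (nij_phi2 tr N)
     (nij_rho \<rho> N S) (nij_mu1 \<mu> N S) (nij_mu2 \<mu> N S)"
  unfolding trivial_linear_deformation_def
proof (intro bexI allI)
  show "N \<in> gl sg" "S \<in> gl sv"
    using N_linear S_linear by (simp_all add: gl_def)
qed (use deformed_hom in \<open>simp add: brt_def trt_def rhot_def mut_def \<alpha>_def \<beta>_def\<close>)

end

theorem theorem3p13:
  fixes sg :: "'k::field_char_0 \<Rightarrow> 'g::ab_group_add \<Rightarrow> 'g"
    and br :: "'g \<Rightarrow> 'g \<Rightarrow> 'g"
    and tr :: "'g \<Rightarrow> 'g \<Rightarrow> 'g \<Rightarrow> 'g"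
    and sv :: "'k \<Rightarrow> 'v::ab_group_add \<Rightarrow> 'v"
    and \<rho> :: "'g \<Rightarrow> 'v \<Rightarrow> 'v"
    and \<mu> :: "'g \<Rightarrow> 'g \<Rightarrow> 'v \<Rightarrow> 'v"
    and N :: "'g \<Rightarrow> 'g"
    and S :: "'v \<Rightarrow> 'v"
  assumes "lieyrep_pair sg br tr sv \<rho> \<mu>"
    and "nijenhuis_structure sg br tr sv \<rho> \<mu> N S"
  shows "generates_linear_deformation sg br tr sv \<rho> \<mu>
           (nij_phi br N) (nij_phi1 tr N) (nij_phi2 tr N)
           (nij_rho \<rho> N S) (nij_mu1 \<mu> N S) (nij_mu2 \<mu> N S)
       \<and> trivial_linear_deformation sg br tr sv \<rho> \<mu>
           (nij_phi br N) (nij_phi1 tr N) (nij_phi2 tr N)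
           (nij_rho \<rho> N S) (nij_mu1 \<mu> N S) (nij_mu2 \<mu> N S)"
proof -
  interpret nijenhuis_pair sg br tr sv \<rho> \<mu> N S
    by (intro nijenhuis_pair.intro nijenhuis_pair_axioms.intro assms)
  show ?thesis
    using generates_deformation deformation_trivial by blast
qed

end
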